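(* Let $n\geq3$. The rank of the monoid $\mathcal{DPC}_n$ is $3$.
   Context: The rank of a finite monoid $M$ is the minimum size of a subset $X\subseteq M$ that generates $M$ (as a monoid). For $n\geq3$, $C_n$ is the cycle graph with vertex set $\{1,\ldots,n\}$ and edges $\{i,i+1\}$ ($1\leq i\leq n-1$) and $\{1,n\}$; $\mathrm{d}(x,y)=\min\{|x-y|,n-|x-y|\}$ is the geodesic distance in $C_n$. $\mathcal{DPC}_n$ is the monoid, under composition, of all partial isometries of $C_n$, i.e. of all partial transformations $\alpha$ of $\{1,\ldots,n\}$ (including the empty one) such that $\mathrm{d}(x\alpha,y\alpha)=\mathrm{d}(x,y)$ for all $x,y\in\mathrm{Dom}(\alpha)$. *)

theory Defs
  imports "HOL-Algebra.Group" "HOL.Hull"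
begin

section \<open>Rank of a finite monoid\<close>

definition generates_monoid :: "('a, 'b) monoid_scheme \<Rightarrow> 'a set \<Rightarrow> bool"
  where "generates_monoid M X \<longleftrightarrow>
    X \<subseteq> carrier M \<and> (\<lambda>H. submonoid H M) hull X = carrier M"

text \<open>Finiteness of the generating set is required explicitly because \<^const>\<open>card\<close> is 0 on
  infinite sets. For a finite monoid the minimum is attained; see \<open>monoid_rank_attained\<close>.\<close>

definition monoid_rank :: "('a, 'b) monoid_scheme \<Rightarrow> nat"
  where "monoid_rank M = (LEAST k. \<exists>X. finite X \<and> card X = k \<and> generates_monoid M X)"

lemma monoid_rank_attained:
  assumes "monoid M" "finite (carrier M)"
  shows "\<exists>X. finite X \<and> card X = monoid_rank M \<and> generates_monoid M X"
proof -
  interpret monoid M by fact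
  have "submonoid (carrier M) M" by unfold_locales auto
  then have "generates_monoid M (carrier M)"
    by (simp add: generates_monoid_def hull_same)
  with assms(2)
  have "\<exists>X. finite X \<and> card X = card (carrier M) \<and> generates_monoid M X" by blast
  then show ?thesis unfolding monoid_rank_def
    by (rule LeastI[where P = "\<lambda>k. \<exists>X. finite X \<and> card X = k \<and> generates_monoid M X"])
qed


section \<open>The cycle graph and its distance\<close>

text \<open>The edges are given as a symmetric relation, so that walks of length \<open>k\<close> are captured
  by relation powers.\<close>

definition cycle_edges :: "nat \<Rightarrow> (nat \<times> nat) set"
  where "cycle_edges n = {(x, y). x \<in> {1..n} \<and> y \<in> {1..n} \<and>
    (y = x + 1 \<or> x = y + 1 \<or> x = 1 \<and> y = n \<or> x = n \<and> y = 1)}"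

definition cycle_dist :: "nat \<Rightarrow> nat \<Rightarrow> nat \<Rightarrow> int"
  where "cycle_dist n x y = min \<bar>int x - int y\<bar> (int n - \<bar>int x - int y\<bar>)"

lemma cycle_dist_le_walk:
  assumes "(x, y) \<in> cycle_edges n ^^ k" "x \<in> {1..n}"
  shows "y \<in> {1..n} \<and> cycle_dist n x y \<le> int k"
  using assms
proof (induction k arbitrary: y)
  case 0
  then show ?case by (auto simp: cycle_dist_def)
next
  case (Suc k)
  then obtain z where z: "(x, z) \<in> cycle_edges n ^^ k" "(z, y) \<in> cycle_edges n"
    by auto
  then have "z \<in> {1..n}" "cycle_dist n x z \<le> int k"
    using Suc by blast+
  moreover have "y \<in> {1..n}" using z by (auto simp: cycle_edges_def)
  moreover have "cycle_dist n x y \<le> cycle_dist n x z + 1"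
    using z(2) Suc.prems unfolding cycle_dist_def cycle_edges_def by auto
  ultimately show ?case by simp
qed

lemma walk_of_cycle_dist:
  assumes "cycle_dist n x y = int k" "x \<in> {1..n}" "y \<in> {1..n}"
  shows "(x, y) \<in> cycle_edges n ^^ k"
  using assms
proof (induction k arbitrary: y)
  case 0
  then show ?case by (auto simp: cycle_dist_def min_def split: if_splits)
next
  case (Suc k)
  define p where "p = (if y = 1 then n else y - 1)"
  define s where "s = (if y = n then 1 else y + 1)"
  have p: "p \<in> {1..n}" "(p, y) \<in> cycle_edges n" and s: "s \<in> {1..n}" "(s, y) \<in> cycle_edges n"
    using Suc.prems by (auto simp: p_def s_def cycle_edges_def)
  have "cycle_dist n x p = int k \<or> cycle_dist n x s = int k"
    using Suc.prems unfolding p_def s_def cycle_dist_def by (auto split: if_splits)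
  then show ?case using Suc.IH p s Suc.prems by auto
qed

lemma cycle_dist_geodesic:
  assumes "x \<in> {1..n}" "y \<in> {1..n}"
  shows "cycle_dist n x y = int (LEAST k. (x, y) \<in> cycle_edges n ^^ k)"
proof -
  have "cycle_dist n x y \<ge> 0" using assms by (auto simp: cycle_dist_def)
  then obtain d where d: "cycle_dist n x y = int d" by (metis nonneg_int_cases)
  have "(LEAST k. (x, y) \<in> cycle_edges n ^^ k) = d"
  proof (rule Least_equality)
    show "(x, y) \<in> cycle_edges n ^^ d" using walk_of_cycle_dist d assms by blast
    show "d \<le> k" if "(x, y) \<in> cycle_edges n ^^ k" for k
      using cycle_dist_le_walk[OF that assms(1)] d by simp
  qed
  with d show ?thesis by simp
qed


section \<open>The monoid of partial isometries\<close>

definition partial_isometries :: "nat \<Rightarrow> (nat \<rightharpoonup> nat) set"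
  where "partial_isometries n = {\<alpha>. dom \<alpha> \<subseteq> {1..n} \<and> ran \<alpha> \<subseteq> {1..n} \<and>
    (\<forall>x \<in> dom \<alpha>. \<forall>y \<in> dom \<alpha>. cycle_dist n (the (\<alpha> x)) (the (\<alpha> y)) = cycle_dist n x y)}"

text \<open>Maps act on the right: the product of \<open>\<alpha>\<close> and \<open>\<beta>\<close> applies \<open>\<alpha>\<close> first, and its domain
  consists of all \<open>x\<close> in the domain of \<open>\<alpha>\<close> whose image is in the domain of \<open>\<beta>\<close>.\<close>

definition DPC :: "nat \<Rightarrow> (nat \<rightharpoonup> nat) monoid"
  where "DPC n = \<lparr>carrier = partial_isometries n, mult = (\<lambda>\<alpha> \<beta>. \<beta> \<circ>\<^sub>m \<alpha>), one = Some |` {1..n}\<rparr>"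

lemma empty_in_DPC: "Map.empty \<in> carrier (DPC n)"
  by (simp add: DPC_def partial_isometries_def)

lemma finite_DPC: "finite (carrier (DPC n))"
proof (rule finite_subset)
  let ?F = "\<Union>A \<in> Pow {1..n}. {\<alpha>. dom \<alpha> = A \<and> ran \<alpha> \<subseteq> {1..n}}"
  show "carrier (DPC n) \<subseteq> ?F" by (auto simp: DPC_def partial_isometries_def)
  show "finite ?F" by (auto intro!: finite_set_of_finite_maps intro: finite_subset)
qed

lemma monoid_DPC: "monoid (DPC n)"
proof (rule monoidI)
  fix \<alpha> \<beta> assume "\<alpha> \<in> carrier (DPC n)" "\<beta> \<in> carrier (DPC n)"
  then have \<alpha>: "\<alpha> \<in> partial_isometries n" and \<beta>: "\<beta> \<in> partial_isometries n"
    by (simp_all add: DPC_def)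
  have iso: "cycle_dist n u v = cycle_dist n x y"
    if "\<gamma> \<in> partial_isometries n" "\<gamma> x = Some u" "\<gamma> y = Some v" for \<gamma> x y u v
  proof -
    have "x \<in> dom \<gamma>" "y \<in> dom \<gamma>" using that by auto
    then have "cycle_dist n (the (\<gamma> x)) (the (\<gamma> y)) = cycle_dist n x y"
      using that(1) unfolding partial_isometries_def by blast
    with that show ?thesis by simp
  qed
  have "dom (\<beta> \<circ>\<^sub>m \<alpha>) \<subseteq> {1..n}"
  proof -
    have "dom \<alpha> \<subseteq> {1..n}" using \<alpha> unfolding partial_isometries_def by blast
    moreover have "dom (\<beta> \<circ>\<^sub>m \<alpha>) \<subseteq> dom \<alpha>" unfolding dom_def by (auto simp: map_comp_Some_iff)
    ultimately show ?thesis by blast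
  qed
  moreover have "ran (\<beta> \<circ>\<^sub>m \<alpha>) \<subseteq> {1..n}"
  proof -
    have "ran \<beta> \<subseteq> {1..n}" using \<beta> unfolding partial_isometries_def by blast
    moreover have "ran (\<beta> \<circ>\<^sub>m \<alpha>) \<subseteq> ran \<beta>" by (auto simp: ran_def map_comp_Some_iff)
    ultimately show ?thesis by blast
  qed
  moreover have "cycle_dist n (the ((\<beta> \<circ>\<^sub>m \<alpha>) x)) (the ((\<beta> \<circ>\<^sub>m \<alpha>) y)) = cycle_dist n x y"
    if xy: "x \<in> dom (\<beta> \<circ>\<^sub>m \<alpha>)" "y \<in> dom (\<beta> \<circ>\<^sub>m \<alpha>)" for x y
  proof -
    obtain u v u' v' where "\<alpha> x = Some u" "\<alpha> y = Some v" "\<beta> u = Some u'" "\<beta> v = Some v'"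
      using xy by (auto simp: map_comp_Some_iff)
    then show ?thesis using iso[OF \<alpha>] iso[OF \<beta>] by simp
  qed
  ultimately show "\<alpha> \<otimes>\<^bsub>DPC n\<^esub> \<beta> \<in> carrier (DPC n)"
    by (simp add: DPC_def partial_isometries_def)
next
  show "\<one>\<^bsub>DPC n\<^esub> \<in> carrier (DPC n)"
    by (auto simp: DPC_def partial_isometries_def ran_def restrict_map_def split: if_splits)
next
  fix \<alpha> \<beta> \<gamma>
  show "\<alpha> \<otimes>\<^bsub>DPC n\<^esub> \<beta> \<otimes>\<^bsub>DPC n\<^esub> \<gamma> = \<alpha> \<otimes>\<^bsub>DPC n\<^esub> (\<beta> \<otimes>\<^bsub>DPC n\<^esub> \<gamma>)"
    by (auto simp: DPC_def map_comp_def fun_eq_iff split: option.splits)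
next
  fix \<alpha> assume "\<alpha> \<in> carrier (DPC n)"
  then have "x \<in> {1..n}" if "\<alpha> x = Some y" for x y
    using that by (auto simp: DPC_def partial_isometries_def)
  then have "(\<alpha> \<circ>\<^sub>m Some |` {1..n}) x = \<alpha> x" for x
    by (cases "\<alpha> x") (auto simp: map_comp_def restrict_map_def)
  then show "\<one>\<^bsub>DPC n\<^esub> \<otimes>\<^bsub>DPC n\<^esub> \<alpha> = \<alpha>" by (auto simp: DPC_def)
next
  fix \<alpha> assume "\<alpha> \<in> carrier (DPC n)"
  then have "y \<in> {1..n}" if "\<alpha> x = Some y" for x y
    using that unfolding DPC_def partial_isometries_def by (auto dest: ranI[where m = \<alpha>])
  then have "(Some |` {1..n} \<circ>\<^sub>m \<alpha>) x = \<alpha> x" for x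
    by (cases "\<alpha> x") (auto simp: map_comp_def restrict_map_def)
  then show "\<alpha> \<otimes>\<^bsub>DPC n\<^esub> \<one>\<^bsub>DPC n\<^esub> = \<alpha>" by (auto simp: DPC_def)
qed

end

theory Submission
  imports Defs "HOL-Number_Theory.Cong"
begin

text \<open>
  Read modulo \<open>n\<close>, a partial isometry \<open>\<alpha>\<close> satisfies \<open>x\<alpha> - y\<alpha> \<equiv> \<plusminus>(x - y)\<close> with a sign depending on
  the pair. If \<open>2(p - q) \<equiv> 0\<close> for all \<open>p, q\<close> in the domain, the signs are immaterial; otherwise any
  pair violating this forces its sign on all points. Hence \<open>\<alpha>\<close> is a restriction of an element
  of the dihedral group, and the monoid is generated by a rotation, a reflection and the
  identity with one point removed, whose conjugates by rotations multiply to every partial identity.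

  Conversely, in a finite monoid the nonunits form an ideal, so a generating set contains a
  generating set of the group of units. That group is not abelian, which requires two units, and a
  nonunit is needed as well.
\<close>

section \<open>Units and generating sets of finite monoids\<close>

lemma generates_monoidD:
  assumes "generates_monoid M X" "submonoid H M" "X \<subseteq> H"
  shows "carrier M \<subseteq> H"
  using assms hull_minimal[of X H "\<lambda>H. submonoid H M"] by (simp add: generates_monoid_def)

lemma generates_monoidI:
  assumes "monoid M" "X \<subseteq> carrier M"
    and "\<And>H. submonoid H M \<Longrightarrow> X \<subseteq> H \<Longrightarrow> carrier M \<subseteq> H"
  shows "generates_monoid M X"
proof -
  interpret monoid M by fact
  have "submonoid (carrier M) M" by unfold_locales auto
  then have "(\<lambda>H. submonoid H M) hull X \<subseteq> carrier M"
    by (intro hull_minimal assms(2))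
  moreover have "carrier M \<subseteq> (\<lambda>H. submonoid H M) hull X"
    using assms(3) unfolding hull_def by blast
  ultimately show ?thesis using assms(2) by (simp add: generates_monoid_def)
qed

context monoid
begin

text \<open>Left multiplication by \<open>y\<close> is undone by left multiplication by
  \<open>x\<close>, so it is injective and, by finiteness, surjective. The preimage \<open>a\<close>
  of \<open>\<one>\<close> is a right inverse of \<open>y\<close> and therefore equals its left
  inverse \<open>x\<close>.\<close>

lemma finite_right_inverse_left_inverse:
  assumes "finite (carrier G)" "x \<in> carrier G" "y \<in> carrier G" "x \<otimes> y = \<one>"
  shows "y \<otimes> x = \<one>"
proof -
  have "inj_on (\<lambda>a. y \<otimes> a) (carrier G)"
    by (rule inj_onI) (metis assms(2-4) l_one m_assoc)
  then have "(\<lambda>a. y \<otimes> a) ` carrier G = carrier G"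
    using assms by (intro endo_inj_surj) auto
  then obtain a where a: "a \<in> carrier G" "y \<otimes> a = \<one>"
    by (metis (no_types, lifting) imageE one_closed)
  then have "a = x" by (metis assms(2-4) l_one m_assoc r_one)
  with a show ?thesis by simp
qed

text \<open>An inverse of \<open>a \<otimes> b\<close> yields a right inverse of \<open>a\<close>
  and a left inverse of \<open>b\<close>; finiteness makes both two-sided. This is the ideal
  property of the nonunits.\<close>

lemma finite_Units_mult_iff:
  assumes "finite (carrier G)" "a \<in> carrier G" "b \<in> carrier G"
  shows "a \<otimes> b \<in> Units G \<longleftrightarrow> a \<in> Units G \<and> b \<in> Units G"
proof
  assume "a \<otimes> b \<in> Units G"
  then obtain c where c: "c \<in> carrier G" "a \<otimes> b \<otimes> c = \<one>" "c \<otimes> (a \<otimes> b) = \<one>"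
    by (auto simp: Units_def)
  have "a \<otimes> (b \<otimes> c) = \<one>" "(c \<otimes> a) \<otimes> b = \<one>"
    using c assms by (simp_all add: m_assoc)
  then have "(b \<otimes> c) \<otimes> a = \<one>" "b \<otimes> (c \<otimes> a) = \<one>"
    using c assms by (auto intro: finite_right_inverse_left_inverse)
  with \<open>a \<otimes> (b \<otimes> c) = \<one>\<close> \<open>(c \<otimes> a) \<otimes> b = \<one>\<close> show "a \<in> Units G \<and> b \<in> Units G"
    using c assms unfolding Units_def by blast
qed auto

text \<open>Nonunits satisfy the condition vacuously, and a product that is a unit has unit factors,
  each commuting with \<open>V\<close>. The set serves to extend commutation from the unit
  generators to all units.\<close>

lemma submonoid_units_commute:
  assumes "finite (carrier G)" "V \<subseteq> carrier G"
  shows "submonoid {a \<in> carrier G. a \<in> Units G \<longrightarrow> (\<forall>v \<in> V. a \<otimes> v = v \<otimes> a)} G"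
proof
  fix a b
  let ?H = "{a \<in> carrier G. a \<in> Units G \<longrightarrow> (\<forall>v \<in> V. a \<otimes> v = v \<otimes> a)}"
  assume a: "a \<in> ?H" and b: "b \<in> ?H"
  have "(a \<otimes> b) \<otimes> v = v \<otimes> (a \<otimes> b)" if "a \<otimes> b \<in> Units G" "v \<in> V" for v
  proof -
    have v: "v \<in> carrier G" using that assms by auto
    have av: "a \<otimes> v = v \<otimes> a" and bv: "b \<otimes> v = v \<otimes> b"
      using that a b finite_Units_mult_iff[OF assms(1)] by auto
    have "(a \<otimes> b) \<otimes> v = a \<otimes> (v \<otimes> b)" using a b v bv by (simp add: m_assoc)
    also have "\<dots> = (a \<otimes> v) \<otimes> b" using a b v by (simp add: m_assoc)
    also have "\<dots> = v \<otimes> (a \<otimes> b)" using a b v av by (simp add: m_assoc)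
    finally show ?thesis .
  qed
  with a b show "a \<otimes> b \<in> ?H" by auto
qed (use assms in auto)

lemma generates_nonunit:
  assumes "generates_monoid G X" "finite (carrier G)" "carrier G \<noteq> Units G"
  shows "\<not> X \<subseteq> Units G"
proof
  assume "X \<subseteq> Units G"
  moreover have "submonoid (Units G) G" by unfold_locales auto
  ultimately show False using generates_monoidD[OF assms(1)] assms(3) by blast
qed

lemma generates_units_commute:
  assumes gen: "generates_monoid G X" and fin: "finite (carrier G)"
    and X: "\<And>u v. u \<in> X \<inter> Units G \<Longrightarrow> v \<in> X \<inter> Units G \<Longrightarrow> u \<otimes> v = v \<otimes> u"
    and ab: "a \<in> Units G" "b \<in> Units G"
  shows "a \<otimes> b = b \<otimes> a"
proof -
  have XG: "X \<subseteq> carrier G" using gen by (simp add: generates_monoid_def)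
  have "carrier G \<subseteq> {a \<in> carrier G. a \<in> Units G \<longrightarrow> (\<forall>v \<in> X \<inter> Units G. a \<otimes> v = v \<otimes> a)}"
    by (rule generates_monoidD[OF gen submonoid_units_commute[OF fin]]) (use XG X in auto)
  then have 1: "c \<otimes> v = v \<otimes> c" if "c \<in> Units G" "v \<in> X \<inter> Units G" for c v
    using that by auto
  \<comment> \<open>Second pass with the roles exchanged: by \<open>1\<close> the unit generators
    commute with every unit, so \<open>V\<close> can now be all of \<open>Units G\<close>.\<close>
  have "carrier G \<subseteq> {a \<in> carrier G. a \<in> Units G \<longrightarrow> (\<forall>v \<in> Units G. a \<otimes> v = v \<otimes> a)}"
    by (rule generates_monoidD[OF gen submonoid_units_commute[OF fin]]) (use XG 1 in auto)
  with ab show ?thesis by auto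
qed

lemma card_generating_ge_3:
  assumes gen: "generates_monoid G X" and fin: "finite (carrier G)"
    and nonunit: "carrier G \<noteq> Units G"
    and ab: "a \<in> Units G" "b \<in> Units G" "a \<otimes> b \<noteq> b \<otimes> a"
  shows "card X \<ge> 3"
proof -
  \<comment> \<open>With at most one unit among the generators, the unit generators would commute
    trivially, and so would \<open>a\<close> and \<open>b\<close>.\<close>
  obtain u v where uv: "u \<in> X \<inter> Units G" "v \<in> X \<inter> Units G" "u \<noteq> v"
    using generates_units_commute[OF gen fin _ ab(1,2)] ab(3) by metis
  obtain w where w: "w \<in> X" "w \<notin> Units G"
    using generates_nonunit[OF gen fin nonunit] by blast
  have "finite X" using gen fin by (auto simp: generates_monoid_def intro: finite_subset)
  then have "card {u, v, w} \<le> card X" using uv w by (intro card_mono) auto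
  moreover have "card {u, v, w} = 3" using uv w by (auto simp: card_insert_if)
  ultimately show ?thesis by simp
qed

end


section \<open>Partial isometries modulo n\<close>

lemma cong_imp_eq_range:
  assumes "[int x = int y] (mod int n)" "x \<in> {1..n}" "y \<in> {1..n}"
  shows "x = y"
proof -
  have "int n dvd int x - int y" using assms(1) by (simp add: cong_iff_dvd_diff)
  moreover have "\<bar>int x - int y\<bar> < int n" using assms by auto
  ultimately have "int x - int y = 0" by (metis dvd_imp_le_int not_le abs_of_nat)
  then show ?thesis by simp
qed

text \<open>Both sides depend only on the two differences, which have absolute value below
  \<open>n\<close>. A congruence between them up to sign therefore means that their difference or
  sum is 0, \<open>n\<close> or \<open>-n\<close>, which is a linear case analysis.\<close>

lemma cycle_dist_eq_iff:
  assumes "x \<in> {1..n}" "y \<in> {1..n}" "u \<in> {1..n}" "v \<in> {1..n}"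
  shows "cycle_dist n x y = cycle_dist n u v \<longleftrightarrow>
    [int x - int y = int u - int v] (mod int n) \<or> [int x - int y = int v - int u] (mod int n)"
proof -
  have dvd: "int n dvd d \<longleftrightarrow> d = 0 \<or> d = int n \<or> d = - int n" if d: "\<bar>d\<bar> < 2 * int n" for d
  proof
    assume "int n dvd d"
    then obtain k where k: "d = int n * k" by auto
    with d assms have "\<bar>k\<bar> < 2" by (simp add: abs_mult)
    then have "k = 0 \<or> k = 1 \<or> k = -1" by linarith
    with k show "d = 0 \<or> d = int n \<or> d = - int n" by auto
  qed auto
  let ?d = "int x - int y" and ?e = "int u - int v"
  have b: "\<bar>?d\<bar> < int n" "\<bar>?e\<bar> < int n" using assms by auto
  have "[?d = ?e] (mod int n) \<longleftrightarrow> ?d - ?e = 0 \<or> ?d - ?e = int n \<or> ?d - ?e = - int n"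
    using b by (subst cong_iff_dvd_diff, intro dvd) linarith
  moreover have "[?d = int v - int u] (mod int n) \<longleftrightarrow>
      ?d - (int v - int u) = 0 \<or> ?d - (int v - int u) = int n \<or> ?d - (int v - int u) = - int n"
    using b by (subst cong_iff_dvd_diff, intro dvd) linarith
  moreover have "min \<bar>d\<bar> (N - \<bar>d\<bar>) = min \<bar>e\<bar> (N - \<bar>e\<bar>) \<longleftrightarrow>
      (d - e = 0 \<or> d - e = N \<or> d - e = - N) \<or> (d + e = 0 \<or> d + e = N \<or> d + e = - N)"
    if "\<bar>d\<bar> < N" "\<bar>e\<bar> < N" for d e N :: int
    using that by smt
  ultimately show ?thesis using b unfolding cycle_dist_def by (simp add: algebra_simps)
qed

text \<open>The sign is read off one pair \<open>p\<close>, \<open>q\<close> with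
  \<open>2 * (g p - g q)\<close> nonzero modulo \<open>m\<close>. Any further point admits this sign
  against \<open>p\<close> or against \<open>q\<close>, and both lead to the constant
  \<open>f p - s * g p\<close> modulo \<open>m\<close>.\<close>

lemma affine_of_pairwise_pm:
  fixes f g :: "'a \<Rightarrow> int" and m :: int
  assumes pm: "\<And>x y. x \<in> A \<Longrightarrow> y \<in> A \<Longrightarrow>
    [f x - f y = g x - g y] (mod m) \<or> [f x - f y = g y - g x] (mod m)"
  shows "\<exists>s c. (s = 1 \<or> s = -1) \<and> (\<forall>x \<in> A. [f x = s * g x + c] (mod m))"
proof (cases "\<exists>p \<in> A. \<exists>q \<in> A. \<not> m dvd 2 * (g p - g q)")
  case True
  then obtain p q where pq: "p \<in> A" "q \<in> A" "\<not> m dvd 2 * (g p - g q)" by blast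
  obtain s :: int where s: "s = 1 \<or> s = -1" "m dvd (f p - f q) - s * (g p - g q)"
    using pm[OF pq(1,2)] unfolding cong_iff_dvd_diff
    by (metis minus_diff_eq mult_1 mult_minus1)
  have "m dvd f z - (s * g z + (f p - s * g p))" if z: "z \<in> A" for z
  proof -
    obtain t :: int where t: "t = s \<or> t = -s" "m dvd (f z - f p) - t * (g z - g p)"
      using pm[OF z pq(1)] s(1) unfolding cong_iff_dvd_diff
      by (metis minus_diff_eq mult_1 mult_minus1 minus_minus)
    obtain t' :: int where t': "t' = s \<or> t' = -s" "m dvd (f z - f q) - t' * (g z - g q)"
      using pm[OF z pq(2)] s(1) unfolding cong_iff_dvd_diff
      by (metis minus_diff_eq mult_1 mult_minus1 minus_minus)
    consider "t = s" | "t' = s" | "t = -s" "t' = -s" using t t' by blast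
    then show ?thesis
    proof cases
      case 1
      then show ?thesis using t(2) by (simp add: algebra_simps)
    next
      case 2
      then show ?thesis using dvd_diff[OF t'(2) s(2)] by (simp add: algebra_simps)
    next
      case 3
      \<comment> \<open>Subtracting the relations of \<open>z\<close> to \<open>p\<close> and to
        \<open>q\<close> gives the pair \<open>p\<close>, \<open>q\<close> the sign
        \<open>-s\<close>; together with its sign \<open>s\<close> this contradicts the choice of
        the pair.\<close>
      then have "m dvd s * (2 * (g p - g q))"
        using dvd_diff[OF dvd_diff[OF t'(2) t(2)] s(2)] by (simp add: algebra_simps)
      then show ?thesis using pq(3) s(1) by (auto simp only: mult_1 mult_minus1 dvd_minus_iff)
    qed
  qed
  then show ?thesis using s(1) unfolding cong_iff_dvd_diff by blast
next
  case False
  show ?thesis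
  proof (cases "A = {}")
    case nonempty: False
    then obtain p where p: "p \<in> A" by blast
    have "m dvd f x - (1 * g x + (f p - g p))" if x: "x \<in> A" for x
    proof -
      have "m dvd (f x - f p) - (g x - g p) \<or> m dvd (f x - f p) - (g p - g x)"
        using pm[OF x p] by (simp add: cong_iff_dvd_diff)
      moreover have "m dvd 2 * (g x - g p)" using False x p by blast
      \<comment> \<open>The two signs differ by \<open>2 * (g x - g p)\<close>, which vanishes
        modulo \<open>m\<close>, so the sign 1 is always available.\<close>
      ultimately have "m dvd (f x - f p) - (g x - g p)"
        using dvd_diff[of m "(f x - f p) - (g p - g x)" "2 * (g x - g p)"]
        by (auto simp: algebra_simps)
      then show ?thesis by (simp add: algebra_simps)
    qed
    then show ?thesis unfolding cong_iff_dvd_diff by blast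
  qed auto
qed


section \<open>Restrictions of dihedral maps\<close>

text \<open>The shift by one before and after reduction places the representative in
  \<open>{1..n}\<close>, so that the class of 0 is the vertex \<open>n\<close>.\<close>

definition residue :: "nat \<Rightarrow> int \<Rightarrow> nat"
  where "residue n z = nat ((z - 1) mod int n) + 1"

text \<open>For \<open>s = 1\<close> these are restricted rotations, for \<open>s = -1\<close>
  restricted reflections. The parameters are not unique: \<open>c\<close> matters only modulo
  \<open>n\<close>, and on small domains both signs can give the same map.\<close>

definition dihedral_map :: "nat \<Rightarrow> int \<Rightarrow> int \<Rightarrow> nat set \<Rightarrow> (nat \<rightharpoonup> nat)"
  where "dihedral_map n s c A = (\<lambda>x. if x \<in> A then Some (residue n (s * int x + c)) else None)"

context
  fixes n :: nat
  assumes n: "n \<ge> 1"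
  notes One_nat_def [simp del]
begin

lemma residue_range: "residue n z \<in> {1..n}"
proof -
  have "(z - 1) mod int n < int n" "(z - 1) mod int n \<ge> 0" using n by simp_all
  then show ?thesis by (auto simp: residue_def)
qed

lemma residue_cong: "[int (residue n z) = z] (mod int n)"
proof -
  have "int (residue n z) = (z - 1) mod int n + 1" using n by (simp add: residue_def)
  then show ?thesis by (simp add: cong_def mod_simps)
qed

lemma residue_eqI: "[z = int x] (mod int n) \<Longrightarrow> x \<in> {1..n} \<Longrightarrow> residue n z = x"
  by (rule cong_imp_eq_range[OF cong_trans[OF residue_cong] residue_range])

lemma residue_eq_iff: "residue n z = residue n w \<longleftrightarrow> [z = w] (mod int n)"
proof
  assume "residue n z = residue n w"
  then show "[z = w] (mod int n)"
    using cong_trans[OF cong_sym[OF residue_cong[of z]]] residue_cong[of w] by simp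
next
  assume "[z = w] (mod int n)"
  then show "residue n z = residue n w"
    by (intro residue_eqI cong_trans[OF _ cong_sym[OF residue_cong]] residue_range)
qed

section \<open>Partial isometries are the restricted dihedral maps\<close>

lemma dihedral_map_in_DPC:
  assumes "A \<subseteq> {1..n}" "s = 1 \<or> s = -1"
  shows "dihedral_map n s c A \<in> carrier (DPC n)"
proof -
  have dom: "dom (dihedral_map n s c A) = A"
    by (auto simp: dihedral_map_def dom_def)
  have ran: "ran (dihedral_map n s c A) \<subseteq> {1..n}"
    using residue_range by (auto simp: dihedral_map_def ran_def split: if_splits)
  have "cycle_dist n (residue n (s * int x + c)) (residue n (s * int y + c)) = cycle_dist n x y"
    if "x \<in> A" "y \<in> A" for x y
  proof -
    have "[int (residue n (s * int x + c)) - int (residue n (s * int y + c)) =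
        (s * int x + c) - (s * int y + c)] (mod int n)"
      by (intro cong_diff residue_cong)
    then show ?thesis using assms that
      by (subst cycle_dist_eq_iff[OF residue_range residue_range]) (auto simp: algebra_simps)
  qed
  then show ?thesis using dom ran assms(1)
    by (simp add: DPC_def partial_isometries_def) (simp add: dihedral_map_def)
qed

text \<open>Preserving \<open>cycle_dist\<close> means preserving differences modulo
  \<open>n\<close> up to sign, so \<open>affine_of_pairwise_pm\<close> applies with
  \<open>\<alpha>\<close> as \<open>f\<close> and the inclusion into the integers as
  \<open>g\<close>.\<close>

lemma DPC_dihedral_map:
  assumes "\<alpha> \<in> carrier (DPC n)"
  obtains s c A where "s = 1 \<or> s = -1" "A \<subseteq> {1..n}" "\<alpha> = dihedral_map n s c A"
proof -
  have \<alpha>: "dom \<alpha> \<subseteq> {1..n}" "ran \<alpha> \<subseteq> {1..n}"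
    "\<And>x y. x \<in> dom \<alpha> \<Longrightarrow> y \<in> dom \<alpha> \<Longrightarrow>
      cycle_dist n (the (\<alpha> x)) (the (\<alpha> y)) = cycle_dist n x y"
    using assms by (auto simp: DPC_def partial_isometries_def)
  have range: "the (\<alpha> x) \<in> {1..n}" if "x \<in> dom \<alpha>" for x
    using that by (intro subsetD[OF \<alpha>(2)] ranI[of _ x]) auto
  have "\<exists>s c. (s = 1 \<or> s = -1) \<and>
      (\<forall>x \<in> dom \<alpha>. [int (the (\<alpha> x)) = s * int x + c] (mod int n))"
  proof (rule affine_of_pairwise_pm)
    fix x y assume xy: "x \<in> dom \<alpha>" "y \<in> dom \<alpha>"
    then have "x \<in> {1..n}" "y \<in> {1..n}" using \<alpha>(1) by blast+
    then show "[int (the (\<alpha> x)) - int (the (\<alpha> y)) = int x - int y] (mod int n) \<or>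
        [int (the (\<alpha> x)) - int (the (\<alpha> y)) = int y - int x] (mod int n)"
      using \<alpha>(3)[OF xy] cycle_dist_eq_iff[OF range[OF xy(1)] range[OF xy(2)]] by blast
  qed
  then obtain s c where sc: "s = 1 \<or> s = -1"
      "\<And>x. x \<in> dom \<alpha> \<Longrightarrow> [int (the (\<alpha> x)) = s * int x + c] (mod int n)"
    by blast
  have "\<alpha> x = dihedral_map n s c (dom \<alpha>) x" for x
  proof (cases "x \<in> dom \<alpha>")
    case True
    then have "residue n (s * int x + c) = the (\<alpha> x)"
      by (intro residue_eqI cong_sym[OF sc(2)] range)
    with True show ?thesis by (auto simp: dihedral_map_def)
  qed (auto simp: dihedral_map_def)
  with sc(1) \<alpha>(1) show ?thesis by (intro that[of s "dom \<alpha>" c]) auto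
qed

section \<open>Products and units of dihedral maps\<close>

lemma dihedral_map_eqI:
  assumes "A = B" "\<And>x. x \<in> A \<Longrightarrow> [s * int x + c = t * int x + d] (mod int n)"
  shows "dihedral_map n s c A = dihedral_map n t d B"
  using assms by (auto simp: dihedral_map_def residue_eq_iff fun_eq_iff)

lemma dihedral_map_one: "\<one>\<^bsub>DPC n\<^esub> = dihedral_map n 1 0 {1..n}"
proof
  fix x
  show "\<one>\<^bsub>DPC n\<^esub> x = dihedral_map n 1 0 {1..n} x"
    using residue_eqI[of "int x" x]
    by (cases "x \<in> {1..n}") (simp_all add: DPC_def dihedral_map_def)
qed

lemma dihedral_map_mult:
  "dihedral_map n s c A \<otimes>\<^bsub>DPC n\<^esub> dihedral_map n t d B =
    dihedral_map n (t * s) (t * c + d) {x \<in> A. residue n (s * int x + c) \<in> B}"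
proof
  fix x
  have "[t * int (residue n (s * int x + c)) + d = t * (s * int x + c) + d] (mod int n)"
    by (intro cong_add cong_mult residue_cong cong_refl)
  then have "residue n (t * int (residue n (s * int x + c)) + d) =
      residue n (t * s * int x + (t * c + d))"
    by (simp add: residue_eq_iff algebra_simps)
  then show "(dihedral_map n s c A \<otimes>\<^bsub>DPC n\<^esub> dihedral_map n t d B) x =
      dihedral_map n (t * s) (t * c + d) {x \<in> A. residue n (s * int x + c) \<in> B} x"
    by (simp add: DPC_def dihedral_map_def map_comp_def)
qed

lemma dihedral_map_mult_total:
  "dihedral_map n s c A \<otimes>\<^bsub>DPC n\<^esub> dihedral_map n t d {1..n} =
    dihedral_map n (t * s) (t * c + d) A"
  using residue_range by (simp only: dihedral_map_mult) simp

lemma dihedral_map_Units: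
  assumes "s = 1 \<or> s = -1"
  shows "dihedral_map n s c {1..n} \<in> Units (DPC n)"
proof -
  \<comment> \<open>Since \<open>s * s = 1\<close>, the inverse of x -> s x + c is x -> s x - s
    c.\<close>
  have "dihedral_map n s c {1..n} \<otimes>\<^bsub>DPC n\<^esub> dihedral_map n s (- s * c) {1..n} = \<one>\<^bsub>DPC n\<^esub>"
    "dihedral_map n s (- s * c) {1..n} \<otimes>\<^bsub>DPC n\<^esub> dihedral_map n s c {1..n} = \<one>\<^bsub>DPC n\<^esub>"
    using assms by (auto simp only: dihedral_map_mult_total dihedral_map_one) auto
  then show ?thesis using assms dihedral_map_in_DPC[of "{1..n}" s] unfolding Units_def by blast
qed

lemma dihedral_map_notin_Units:
  assumes "x \<in> {1..n}" "x \<notin> A"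
  shows "dihedral_map n s c A \<notin> Units (DPC n)"
proof
  assume "dihedral_map n s c A \<in> Units (DPC n)"
  then obtain \<beta> where "dihedral_map n s c A \<otimes>\<^bsub>DPC n\<^esub> \<beta> = \<one>\<^bsub>DPC n\<^esub>"
    by (auto simp: Units_def)
  then have "(dihedral_map n s c A \<otimes>\<^bsub>DPC n\<^esub> \<beta>) x = \<one>\<^bsub>DPC n\<^esub> x" by simp
  then show False using assms by (simp add: DPC_def dihedral_map_def map_comp_def)
qed

section \<open>Generation by a rotation, a reflection and a partial identity\<close>

lemma generates_DPC:
  "generates_monoid (DPC n)
    {dihedral_map n 1 1 {1..n}, dihedral_map n (-1) 0 {1..n}, dihedral_map n 1 0 ({1..n} - {n})}"
  (is "generates_monoid _ ?X")
proof (rule generates_monoidI[OF monoid_DPC])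
  show "?X \<subseteq> carrier (DPC n)" by (auto intro!: dihedral_map_in_DPC)
next
  fix H assume H: "submonoid H (DPC n)" and X: "?X \<subseteq> H"
  note mult = submonoid.m_closed[OF H]
  have nat_rot: "dihedral_map n 1 (int k) {1..n} \<in> H" for k
  proof (induction k)
    case 0
    then show ?case using submonoid.one_closed[OF H] by (simp add: dihedral_map_one)
  next
    case (Suc k)
    have "dihedral_map n 1 (int k) {1..n} \<otimes>\<^bsub>DPC n\<^esub> dihedral_map n 1 1 {1..n} \<in> H"
      using Suc X by (intro mult) auto
    then show ?case by (simp add: dihedral_map_mult_total add.commute)
  qed
  have rot: "dihedral_map n 1 c {1..n} \<in> H" for c
  proof -
    \<comment> \<open>Reduction modulo \<open>n\<close> turns a negative shift into a nonnegative
      power of the generating rotation.\<close>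
    have "dihedral_map n 1 c {1..n} = dihedral_map n 1 (int (nat (c mod int n))) {1..n}"
      using n by (intro dihedral_map_eqI) (auto simp: cong_def mod_simps)
    then show ?thesis by (simp only: nat_rot)
  qed
  have total: "dihedral_map n s c {1..n} \<in> H" if "s = 1 \<or> s = -1" for s c
  proof -
    have "dihedral_map n (-1) 0 {1..n} \<otimes>\<^bsub>DPC n\<^esub> dihedral_map n 1 c {1..n} \<in> H"
      using X rot by (intro mult) auto
    then show ?thesis using that rot by (auto simp: dihedral_map_mult_total)
  qed
  have remove1: "dihedral_map n 1 0 ({1..n} - {i}) \<in> H" if i: "i \<in> {1..n}" for i
  proof -
    \<comment> \<open>The rotation by \<open>- int i\<close> moves exactly the vertex
      \<open>i\<close> to the removed vertex \<open>n\<close>; rotating back afterwards leaves the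
      identity without \<open>i\<close>.\<close>
    have "residue n (int x - int i) = n \<longleftrightarrow> x = i" if "x \<in> {1..n}" for x
    proof -
      have "residue n (int x - int i) = n \<longleftrightarrow> [int x - int i = int n] (mod int n)"
        using residue_eqI[of "int n" n] residue_eq_iff[of "int x - int i" "int n"] n by simp
      also have "\<dots> \<longleftrightarrow> [int x = int i] (mod int n)"
        by (simp add: cong_iff_dvd_diff dvd_diff_left_iff)
      also have "\<dots> \<longleftrightarrow> x = i" using cong_imp_eq_range that i by auto
      finally show ?thesis .
    qed
    then have *: "{x \<in> {1..n}. residue n (1 * int x + - int i) \<in> {1..n} - {n}} = {1..n} - {i}"
      using residue_range by (auto simp del: atLeastAtMost_iff)
    have "(dihedral_map n 1 (- int i) {1..n} \<otimes>\<^bsub>DPC n\<^esub> dihedral_map n 1 0 ({1..n} - {n}))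
        \<otimes>\<^bsub>DPC n\<^esub> dihedral_map n 1 (int i) {1..n} \<in> H"
      using X rot by (intro mult) auto
    moreover have "dihedral_map n 1 (- int i) {1..n} \<otimes>\<^bsub>DPC n\<^esub> dihedral_map n 1 0 ({1..n} - {n}) =
        dihedral_map n 1 (- int i) ({1..n} - {i})"
      unfolding dihedral_map_mult * by simp
    ultimately show ?thesis by (simp add: dihedral_map_mult_total)
  qed
  have remove: "dihedral_map n 1 0 ({1..n} - B) \<in> H" if "finite B" "B \<subseteq> {1..n}" for B
    using that
  proof (induction B)
    case empty
    then show ?case using rot by simp
  next
    case (insert i B)
    have *: "{x \<in> {1..n} - B. residue n (1 * int x + 0) \<in> {1..n} - {i}} = {1..n} - insert i B"
      using residue_eqI[of "int x" x for x] by auto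
    have "dihedral_map n 1 0 ({1..n} - B) \<otimes>\<^bsub>DPC n\<^esub> dihedral_map n 1 0 ({1..n} - {i}) \<in> H"
      using insert by (intro mult remove1) auto
    then show ?case unfolding dihedral_map_mult * by simp
  qed
  show "carrier (DPC n) \<subseteq> H"
  proof
    fix \<alpha> assume "\<alpha> \<in> carrier (DPC n)"
    then obtain s c A where \<alpha>: "s = 1 \<or> s = -1" "A \<subseteq> {1..n}" "\<alpha> = dihedral_map n s c A"
      by (rule DPC_dihedral_map)
    \<comment> \<open>Every element is the partial identity on its domain followed by a total
      dihedral map.\<close>
    have "dihedral_map n 1 0 ({1..n} - ({1..n} - A)) \<in> H" by (intro remove) auto
    then have "dihedral_map n 1 0 A \<in> H" using \<alpha>(2) by (simp add: double_diff)
    then have "dihedral_map n 1 0 A \<otimes>\<^bsub>DPC n\<^esub> dihedral_map n s c {1..n} \<in> H"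
      using \<alpha>(1) total by (intro mult) auto
    then show "\<alpha> \<in> H" using \<alpha>(3) by (simp add: dihedral_map_mult_total)
  qed
qed

end

section \<open>Noncommuting units and the rank\<close>

lemma rotation_reflection_noncommute:
  assumes "n \<ge> 3"
  shows "dihedral_map n 1 1 {1..n} \<otimes>\<^bsub>DPC n\<^esub> dihedral_map n (-1) 0 {1..n} \<noteq>
    dihedral_map n (-1) 0 {1..n} \<otimes>\<^bsub>DPC n\<^esub> dihedral_map n 1 1 {1..n}"
proof
  assume "dihedral_map n 1 1 {1..n} \<otimes>\<^bsub>DPC n\<^esub> dihedral_map n (-1) 0 {1..n} =
    dihedral_map n (-1) 0 {1..n} \<otimes>\<^bsub>DPC n\<^esub> dihedral_map n 1 1 {1..n}"
  \<comment> \<open>The two products are x -> -x - 1 and x -> -x + 1. At the vertex 1 they give the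
    classes of -2 and 0, which differ as \<open>n \<ge> 3\<close> does not divide 2.\<close>
  then have "dihedral_map n (-1) (-1) {1..n} 1 = dihedral_map n (-1) 1 {1..n} 1"
    using assms by (simp add: dihedral_map_mult_total del: One_nat_def)
  then have "residue n (-2) = residue n 0"
    using assms by (simp add: dihedral_map_def)
  then have "int n dvd 2"
    using assms by (simp add: residue_eq_iff cong_iff_dvd_diff)
  then show False using assms zdvd_imp_le by fastforce
qed

theorem theorem1p5:
  fixes n :: nat
  assumes "n \<ge> 3"
  shows "monoid_rank (DPC n) = 3"
proof (rule antisym)
  have n: "n \<ge> 1" using assms by simp
  let ?X = "{dihedral_map n 1 1 {1..n}, dihedral_map n (-1) 0 {1..n},
    dihedral_map n 1 0 ({1..n} - {n})}"
  have "monoid_rank (DPC n) \<le> card ?X"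
    unfolding monoid_rank_def by (intro Least_le exI[of _ ?X] conjI generates_DPC[OF n]) simp_all
  \<comment> \<open>Bounding by the length of a list makes it unnecessary to show that the three
    maps are distinct.\<close>
  also have "card ?X \<le> 3" by (rule order_trans[OF card_length[of "[_, _, _]", simplified]]) simp
  finally show "monoid_rank (DPC n) \<le> 3" .
next
  have n: "n \<ge> 1" using assms by simp
  interpret monoid "DPC n" by (rule monoid_DPC)
  obtain X where X: "card X = monoid_rank (DPC n)" "generates_monoid (DPC n) X"
    using monoid_rank_attained[OF monoid_DPC finite_DPC] by blast
  \<comment> \<open>The required nonunit is the identity with the vertex \<open>n\<close> removed,
    as it is undefined there.\<close>
  have "dihedral_map n 1 0 ({1..n} - {n}) \<in> carrier (DPC n) - Units (DPC n)"
    using n by (intro DiffI dihedral_map_in_DPC dihedral_map_notin_Units[of n n]) simp_all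
  then have "carrier (DPC n) \<noteq> Units (DPC n)" by blast
  then have "card X \<ge> 3"
    by (rule card_generating_ge_3[OF X(2) finite_DPC _ _ _ rotation_reflection_noncommute[OF assms]])
      (rule dihedral_map_Units[OF n], simp)+
  with X(1) show "3 \<le> monoid_rank (DPC n)" by simp
qed

end
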